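(* Let $V=\oplus_{q\in\frac12\mathbb{Z}}V_{(q)}$ be a conformal vertex superalgebra such that $V$ is strongly generated by $V_{(\frac32)}+V_{(2)}$. Consider the non-associative algebra $V_{(2)}$ with product $ab=a_1b$ and define a left action of $V_{(2)}$ on $V_{(\frac32)}$ by $$av=\tfrac43a_1v\quad\text{for }a\in V_{(2)},\ v\in V_{(\frac32)}.$$ Then the identity $\frac12\omega$ of $V_{(2)}$ acts as the identity on $V_{(\frac32)}$ and $$a(bv)=(ab)v\quad\text{for }a,b\in V_{(2)},\ v\in V_{(\frac32)}.$$ Furthermore, the bilinear form $\langle\cdot,\cdot\rangle$ on $V_{(\frac32)}$ and the bilinear map $\circ:V_{(\frac32)}\times V_{(\frac32)}\to V_{(2)}$, defined by $u_2v=\langle u,v\rangle\mathbf 1$ and $u\circ v=u_0v$ for $u,v\in V_{(\frac32)}$, are symmetric, and for $a\in V_{(2)}$, $u,v\in V_{(\frac32)}$, $$\langle au,v\rangle=\langle u,av\rangle=\tfrac43\langle a,u\circ v\rangle,\qquad (au)\circ v=a(u\circ v)=u\circ(av),$$ where the bilinear form on $V_{(2)}$ is defined by $a_3b=\langle a,b\rangle\mathbf 1$ for $a,b\in V_{(2)}$.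
   Context: A conformal vertex superalgebra is $(V,Y,\mathbf 1,\omega)$ with $V=\oplus_{q\in\frac12\mathbb{Z}}V_{(q)}\neq0$ a complex vector space with parity decomposition $V^{\bar0}=\oplus_{n\in\mathbb{Z}}V_{(n)}$, $V^{\bar1}=\oplus_{n\in\mathbb{Z}}V_{(n+\frac12)}$, a linear map $Y(v,z)=\sum_n v_nz^{-n-1}\in(\mathrm{End}\,V)[[z,z^{-1}]]$, and even vectors $\mathbf 1,\omega$, such that: $u_nv\in V^{\alpha+\beta}$ for $u\in V^\alpha,v\in V^\beta$ and $u_nv=0$ for $n$ large; for parity-homogeneous $u,v$ and $m,n,k\in\mathbb{Z}$, $\sum_{i\ge0}(-1)^i\binom mi(u_{m+k-i}v_{n+i}-(-1)^{|u||v|}(-1)^mv_{m+n-i}u_{k+i})=\sum_{i\ge0}\binom ki(u_{m+i}v)_{n+k-i}$ (Jacobi identity); $\mathbf 1_mv=\delta_{m,-1}v$, $v_{-1}\mathbf 1=v$, $v_n\mathbf 1=0$ for $n\ge0$; $L(n)=\omega_{n+1}$ satisfy $[L(m),L(n)]=(m-n)L(m+n)+\frac{m^3-m}{12}\delta_{m+n,0}c_V$ for some $c_V\in\mathbb{C}$; $Y(L(-1)v,z)=\frac{d}{dz}Y(v,z)$; and $V_{(q)}=\{v: L(0)v=qv\}$. No finite-dimensionality or lower truncation of the grading is assumed. $V$ is strongly generated by a subset $T$ if $V$ is spanned by $\mathbf 1$ and the vectors $a^{(1)}_{-n_1}\cdots a^{(r)}_{-n_r}\mathbf 1$ with $r\ge1$,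 $a^{(i)}\in T$, $n_i$ positive integers. For $V$ strongly generated by $V_{(\frac32)}+V_{(2)}$ one has $V_{(0)}=\mathbb{C}\mathbf 1$, so the forms are well defined. The algebra $V_{(2)}$ is commutative with identity $\frac12\omega$ but not necessarily associative. *)

theory Defs
  imports Complex_Main "HOL-Library.Groups_Big_Fun" "HOL-Library.Z2"
begin

text \<open>
  A vertex superalgebra structure on the complex vector space \<open>'v\<close> is given through the modes of
  the fields: \<open>Y v n\<close> is the endomorphism \<open>v_n\<close> with \<open>Y(v,z) = \<Sum>n. v_n z^(-n-1)\<close>.
\<close>

definition virasoro :: "('v \<Rightarrow> int \<Rightarrow> 'v \<Rightarrow> 'v) \<Rightarrow> 'v \<Rightarrow> int \<Rightarrow> 'v \<Rightarrow> 'v" where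
  "virasoro Y \<omega> n = Y \<omega> (n + 1)"

definition weight_space ::
  "(complex \<Rightarrow> 'v \<Rightarrow> 'v) \<Rightarrow> ('v \<Rightarrow> int \<Rightarrow> 'v \<Rightarrow> 'v) \<Rightarrow> 'v \<Rightarrow> complex \<Rightarrow> 'v set" where
  "weight_space scale Y \<omega> q = {v. virasoro Y \<omega> 0 v = scale q v}"

definition parity_space ::
  "(complex \<Rightarrow> 'v \<Rightarrow> 'v) \<Rightarrow> ('v \<Rightarrow> int \<Rightarrow> 'v \<Rightarrow> 'v) \<Rightarrow> 'v::ab_group_add \<Rightarrow> bit \<Rightarrow> 'v set" where
  "parity_space scale Y \<omega> \<alpha> =
     module.span scale
       (\<Union>n::int. weight_space scale Y \<omega> (if \<alpha> = 0 then of_int n else of_int n + 1/2))"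

definition parity_sign :: "bit \<Rightarrow> bit \<Rightarrow> complex" where
  "parity_sign \<alpha> \<beta> = (if \<alpha> * \<beta> = 1 then -1 else 1)"

text \<open>The whole space is the internal direct sum of the subspaces \<open>A i\<close>, \<open>i \<in> I\<close>.\<close>

definition is_direct_sum :: "'i set \<Rightarrow> ('i \<Rightarrow> 'v::comm_monoid_add set) \<Rightarrow> bool" where
  "is_direct_sum I A \<longleftrightarrow>
     (\<forall>v. \<exists>!f. (\<forall>i\<in>I. f i \<in> A i) \<and> (\<forall>i. i \<notin> I \<longrightarrow> f i = 0) \<and>
               finite {i. f i \<noteq> 0} \<and> (\<Sum>i | f i \<noteq> 0. f i) = v)"

text \<open>
  In the Jacobi identity \<open>Sum_any\<close> is the sum over all \<open>i\<close> of a finitely supported family; the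
  supports are finite by \<open>truncation\<close>. The axiom \<open>translation\<close> is the coefficient of \<open>z^(-n-1)\<close>
  in \<open>Y(L(-1)v,z) = d/dz Y(v,z)\<close>.
\<close>

locale conformal_vertex_superalgebra = vector_space scale
  for scale :: "complex \<Rightarrow> 'v::ab_group_add \<Rightarrow> 'v" +
  fixes Y :: "'v \<Rightarrow> int \<Rightarrow> 'v \<Rightarrow> 'v"
    and vac :: 'v
    and \<omega> :: 'v
  assumes nonzero: "\<exists>v::'v. v \<noteq> 0"
    and linear_state: "Vector_Spaces.linear scale scale (\<lambda>u. Y u n v)"
    and linear_mode: "Vector_Spaces.linear scale scale (Y u n)"
    and grading: "is_direct_sum {q. 2 * q \<in> \<int>} (weight_space scale Y \<omega>)"
    and vac_even: "vac \<in> parity_space scale Y \<omega> 0"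
    and omega_even: "\<omega> \<in> parity_space scale Y \<omega> 0"
    and parity_mode:
      "\<lbrakk>u \<in> parity_space scale Y \<omega> \<alpha>; v \<in> parity_space scale Y \<omega> \<beta>\<rbrakk>
        \<Longrightarrow> Y u n v \<in> parity_space scale Y \<omega> (\<alpha> + \<beta>)"
    and truncation:
      "\<lbrakk>u \<in> parity_space scale Y \<omega> \<alpha>; v \<in> parity_space scale Y \<omega> \<beta>\<rbrakk>
        \<Longrightarrow> \<exists>N. \<forall>n\<ge>N. Y u n v = 0"
    and jacobi:
      "\<lbrakk>u \<in> parity_space scale Y \<omega> \<alpha>; v \<in> parity_space scale Y \<omega> \<beta>\<rbrakk>
        \<Longrightarrow> Sum_any (\<lambda>i::nat. scale ((-1) ^ i * (of_int m gchoose i))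
                (Y u (m + k - int i) (Y v (n + int i) w)
                 - scale (parity_sign \<alpha> \<beta> * (-1) powi m)
                     (Y v (m + n - int i) (Y u (k + int i) w))))
            = Sum_any (\<lambda>i::nat. scale (of_int k gchoose i)
                (Y (Y u (m + int i) v) (n + k - int i) w))"
    and vacuum_mode: "Y vac m v = (if m = -1 then v else 0)"
    and creation: "Y v (-1) vac = v"
    and creation_regular: "n \<ge> 0 \<Longrightarrow> Y v n vac = 0"
    and virasoro_relations:
      "\<exists>c. \<forall>m n v.
         virasoro Y \<omega> m (virasoro Y \<omega> n v) - virasoro Y \<omega> n (virasoro Y \<omega> m v) =
         scale (of_int (m - n)) (virasoro Y \<omega> (m + n) v)
         + (if m + n = 0 then scale (of_int (m ^ 3 - m) / 12 * c) v else 0)"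
    and translation: "Y (virasoro Y \<omega> (-1) v) n w = scale (- of_int n) (Y v (n - 1) w)"

definition strongly_generated_by ::
  "(complex \<Rightarrow> 'v::ab_group_add \<Rightarrow> 'v) \<Rightarrow> ('v \<Rightarrow> int \<Rightarrow> 'v \<Rightarrow> 'v) \<Rightarrow> 'v \<Rightarrow> 'v set \<Rightarrow> bool" where
  "strongly_generated_by scale Y vac T \<longleftrightarrow>
     module.span scale
       (insert vac {foldr (\<lambda>(a, n) w. Y a (- int n) w) xs vac | xs.
          xs \<noteq> [] \<and> (\<forall>(a, n) \<in> set xs. a \<in> T \<and> n > 0)}) = UNIV"

definition vac_coeff :: "(complex \<Rightarrow> 'v \<Rightarrow> 'v) \<Rightarrow> 'v \<Rightarrow> 'v \<Rightarrow> complex" where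
  "vac_coeff scale vac w = (THE c. w = scale c vac)"

definition bilinear_map_on ::
  "(complex \<Rightarrow> 'a \<Rightarrow> 'a) \<Rightarrow> (complex \<Rightarrow> 'b \<Rightarrow> 'b) \<Rightarrow> (complex \<Rightarrow> 'c \<Rightarrow> 'c) \<Rightarrow>
   'a::ab_group_add set \<Rightarrow> 'b::ab_group_add set \<Rightarrow> 'c::ab_group_add set \<Rightarrow> ('a \<Rightarrow> 'b \<Rightarrow> 'c) \<Rightarrow> bool"
  where
  "bilinear_map_on sA sB sC A B C f \<longleftrightarrow>
     (\<forall>x\<in>A. \<forall>y\<in>B. f x y \<in> C) \<and>
     (\<forall>x\<in>A. \<forall>x'\<in>A. \<forall>y\<in>B. f (x + x') y = f x y + f x' y) \<and>
     (\<forall>x\<in>A. \<forall>y\<in>B. \<forall>y'\<in>B. f x (y + y') = f x y + f x y') \<and>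
     (\<forall>c. \<forall>x\<in>A. \<forall>y\<in>B. f (sA c x) y = sC c (f x y) \<and> f x (sB c y) = sC c (f x y))"

end

theory Submission
  imports Defs
begin

text \<open>
  Write \<open>V_q\<close> for the weight spaces, \<open>L(n)\<close> for the Virasoro modes \<open>\<omega>_(n+1)\<close>, and take
  \<open>a, b \<in> V_2\<close> and \<open>u, v \<in> V_(3/2)\<close> throughout. Strong generation enters only through the
  low weights. Every monomial in the generators other than the vacuum has weight at least
  \<open>3/2\<close>, and the only monomials of weight \<open>5/2\<close> are \<open>u_(-2)1 = L(-1)u\<close>. Comparing with the
  grading (\<open>wt_eq_predicted_wt\<close>), one gets \<open>V_0 = \<complex>1\<close>, \<open>V_(5/2) = L(-1)V_(3/2)\<close>, and \<open>V_q = 0\<close>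
  for \<open>q < 0\<close> and \<open>q = 1/2, 1\<close>. Therefore \<open>a_n b\<close>, \<open>a_n v\<close> and \<open>u_n v\<close> vanish for all but
  two or three values \<open>n \<ge> 0\<close>, and skew symmetry has no correction terms: \<open>ab = ba\<close>, and both the form and the
  product \<open>\<circ>\<close> on \<open>V_(3/2)\<close> are symmetric.

  The decisive point is that \<open>a_0 v\<close> has weight \<open>5/2\<close> and so equals \<open>L(-1)w\<close> for some \<open>w\<close> of
  weight \<open>3/2\<close>. Applying \<open>L(1)\<close> to both sides identifies \<open>w\<close>, and the result is
  \<open>a_0 v = (2/3) L(-1) a_1 v\<close> (\<open>mode_0_eq_translation\<close>). Whenever the Jacobi identity produces
  the mode \<open>a_0\<close>, it can now be rewritten through \<open>a_1\<close>.

  The claims then follow by comparing expansions. For associativity, expanding \<open>(a_1 b)_1\<close> gives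
  \<open>(ab)_1 v = a_1 b_1 v + (1/3) b_1 a_1 v\<close>. Exchanging \<open>a\<close> and \<open>b\<close> does not change the left
  hand side, so \<open>a_1 b_1 v = b_1 a_1 v\<close> and \<open>(ab)_1 v = (4/3) a_1 b_1 v\<close>; this is where the
  normalization \<open>4/3\<close> of the action comes from. For \<open>\<circ>\<close>, put \<open>X = a_1 u_0 v\<close>,
  \<open>P = u_0 a_1 v\<close> and \<open>Q = (a_1 u)_0 v\<close>. The commutator of \<open>a_1\<close> and \<open>u_0\<close> gives \<open>X = P + Q/3\<close>,
  the expansion of \<open>(a_1 u)_0\<close> gives \<open>X = Q + P/3\<close>, so \<open>P = Q\<close> and \<open>X = (4/3) P\<close>. In the same
  way \<open>(a_1 u)_2 v = u_2 a_1 v\<close> and \<open>a_3 u_0 v = (a_1 u)_2 v\<close>, which are the statements about the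
  forms.
\<close>

section \<open>Consequences of the Jacobi identity\<close>

context conformal_vertex_superalgebra
begin

abbreviation wt :: "complex \<Rightarrow> 'v set" where
  "wt q \<equiv> weight_space scale Y \<omega> q"

abbreviation par :: "bit \<Rightarrow> 'v set" where
  "par \<alpha> \<equiv> parity_space scale Y \<omega> \<alpha>"

lemma mode_add: "Y u n (v + w) = Y u n v + Y u n w"
  and mode_scale: "Y u n (scale c v) = scale c (Y u n v)"
  using linear_mode[of u n] by (auto simp: Vector_Spaces.linear_iff)

lemma state_add: "Y (u + v) n w = Y u n w + Y v n w"
  and state_scale: "Y (scale c u) n w = scale c (Y u n w)"
  using linear_state[of n w] by (auto simp: Vector_Spaces.linear_iff)

lemma mode_zero [simp]: "Y u n 0 = 0"
  using mode_scale[of u n 0 0] by simp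

lemma state_zero [simp]: "Y 0 n w = 0"
  using state_scale[of 0 0 n w] by simp

text \<open>
  Two vectors that are exchanged by a symmetric linear relation agree. This is how the two
  expansions of the same product are played off against each other below.
\<close>

lemma linear_relation_cancel:
  assumes "x + scale c y = y + scale c x" "c \<noteq> 1"
  shows "x = y"
proof -
  have "scale (1 - c) (x - y) = 0"
    using assms(1) by (simp add: scale_left_diff_distrib scale_right_diff_distrib algebra_simps)
  then show ?thesis
    using assms(2) by simp
qed

lemma vac_nonzero: "vac \<noteq> 0"
proof
  assume "vac = 0"
  then have "v = 0" for v :: 'v
    using vacuum_mode[of "-1" v] by simp
  then show False
    using nonzero by blast
qed

lemma subspace_wt: "subspace (wt q)"
  by (auto simp: weight_space_def virasoro_def subspace_def mode_add mode_scale
      scale_right_distrib mult.commute)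

lemma wt_parity_even: "v \<in> wt (of_int n) \<Longrightarrow> v \<in> par 0"
  unfolding parity_space_def by (intro span_base) auto

lemma wt_parity_odd: "v \<in> wt (of_int n + 1/2) \<Longrightarrow> v \<in> par 1"
  unfolding parity_space_def by (intro span_base) auto

text \<open>
  The parameter values \<open>m = 0\<close>, \<open>k \<ge> 0\<close> of the Jacobi identity: on the left \<open>0 choose i\<close> leaves
  one term, on the right \<open>k choose i\<close> leaves \<open>k + 1\<close> of them.
\<close>

lemma commutator_formula:
  assumes "u \<in> par \<alpha>" "v \<in> par \<beta>"
  shows "Y u (int m) (Y v n w) - scale (parity_sign \<alpha> \<beta>) (Y v n (Y u (int m) w))
       = (\<Sum>i\<le>m. scale (of_nat (m choose i)) (Y (Y u (int i) v) (int m + n - int i) w))"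
proof -
  let ?l = "\<lambda>i::nat. scale ((-1) ^ i * (of_int 0 gchoose i))
                (Y u (0 + int m - int i) (Y v (n + int i) w)
                 - scale (parity_sign \<alpha> \<beta> * (-1) powi 0)
                     (Y v (0 + n - int i) (Y u (int m + int i) w)))"
  let ?r = "\<lambda>i::nat. scale (of_int (int m) gchoose i)
                (Y (Y u (0 + int i) v) (n + int m - int i) w)"
  have "Sum_any ?l = sum ?l {0}"
  proof (rule Sum_any.expand_superset)
    have "?l i = 0" if "i > 0" for i
      using that by (simp add: gbinomial_0_left)
    then show "{i. ?l i \<noteq> 0} \<subseteq> {0}"
      by blast
  qed auto
  moreover have "Sum_any ?r = sum ?r {..m}"
  proof (rule Sum_any.expand_superset)
    have "of_nat m gchoose i = (0::complex)" if "m < i" for i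
      using that by (simp flip: binomial_gbinomial add: binomial_eq_0)
    then have "?r i = 0" if "i \<notin> {..m}" for i
      using that by simp
    then show "{i. ?r i \<noteq> 0} \<subseteq> {..m}"
      by blast
  qed auto
  moreover have "Sum_any ?l = Sum_any ?r"
    by (rule jacobi[OF assms])
  ultimately show ?thesis
    by (simp add: binomial_gbinomial add.commute)
qed

text \<open>
  The parameter values \<open>m = 1\<close>, \<open>k = 0\<close>, for which the right hand side of the Jacobi identity is a
  single mode of \<open>u_1 v\<close>. It expresses the modes of a product in \<open>V_2\<close>, or of \<open>a_1 u\<close> with \<open>u\<close> in
  \<open>V_(3/2)\<close>, by modes of the factors.
\<close>

lemma first_product_formula:
  assumes "u \<in> par 0" "v \<in> par \<beta>"
  shows "Y (Y u 1 v) n w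
       = Y u 1 (Y v n w) - Y u 0 (Y v (n + 1) w) + Y v (n + 1) (Y u 0 w) - Y v n (Y u 1 w)"
proof -
  let ?l = "\<lambda>i::nat. scale ((-1) ^ i * (of_int 1 gchoose i))
                (Y u (1 + 0 - int i) (Y v (n + int i) w)
                 - scale (parity_sign 0 \<beta> * (-1) powi 1)
                     (Y v (1 + n - int i) (Y u (0 + int i) w)))"
  let ?r = "\<lambda>i::nat. scale (of_int 0 gchoose i)
                (Y (Y u (1 + int i) v) (n + 0 - int i) w)"
  have "Sum_any ?l = sum ?l {0, 1}"
  proof (rule Sum_any.expand_superset)
    have "?l i = 0" if "i \<notin> {0, 1}" for i
    proof -
      have "1 gchoose i = (0::complex)"
        using that binomial_gbinomial[of 1 i, where 'a = complex] by (simp add: binomial_eq_0)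
      then show ?thesis
        by simp
    qed
    then show "{i. ?l i \<noteq> 0} \<subseteq> {0, 1}"
      by blast
  qed auto
  moreover have "Sum_any ?r = sum ?r {0}"
  proof (rule Sum_any.expand_superset)
    have "?r i = 0" if "i > 0" for i
      using that by (simp add: gbinomial_0_left)
    then show "{i. ?r i \<noteq> 0} \<subseteq> {0}"
      by blast
  qed auto
  moreover have "Sum_any ?l = Sum_any ?r"
    by (rule jacobi[OF assms])
  ultimately show ?thesis
    by (simp add: parity_sign_def algebra_simps)
qed

text \<open>
  The parameter values \<open>n = 0\<close>, \<open>k = -1\<close> applied to the vacuum: since nonnegative modes annihilate
  it, the left hand side reduces to \<open>v_m u\<close>. The corrections \<open>(u_(m+i) v)_(-1-i) 1\<close> on the right are
  multiples of \<open>L(-1)^i u_(m+i) v\<close>. They are assumed to vanish because this holds in every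
  case below, the vectors \<open>u_(m+i) v\<close> then being zero or multiples of the vacuum.
\<close>

lemma skew_symmetry:
  assumes "u \<in> par \<alpha>" "v \<in> par \<beta>"
    and vanish: "\<And>i::nat. i > 0 \<Longrightarrow> Y (Y u (m + int i) v) (- 1 - int i) vac = 0"
  shows "Y u m v = scale (- parity_sign \<alpha> \<beta> * (-1) powi m) (Y v m u)"
proof -
  let ?l = "\<lambda>i::nat. scale ((-1) ^ i * (of_int m gchoose i))
                (Y u (m + (-1) - int i) (Y v (0 + int i) vac)
                 - scale (parity_sign \<alpha> \<beta> * (-1) powi m)
                     (Y v (m + 0 - int i) (Y u (-1 + int i) vac)))"
  let ?r = "\<lambda>i::nat. scale (of_int (-1) gchoose i)
                (Y (Y u (m + int i) v) (0 + (-1) - int i) vac)"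
  have "Sum_any ?l = sum ?l {0}"
  proof (rule Sum_any.expand_superset)
    have "?l i = 0" if "i > 0" for i
      using that by (simp add: creation_regular)
    then show "{i. ?l i \<noteq> 0} \<subseteq> {0}"
      by blast
  qed auto
  moreover have "Sum_any ?r = sum ?r {0}"
  proof (rule Sum_any.expand_superset)
    have "?r i = 0" if "i > 0" for i
      using vanish[OF that] by simp
    then show "{i. ?r i \<noteq> 0} \<subseteq> {0}"
      by blast
  qed auto
  moreover have "Sum_any ?l = Sum_any ?r"
    by (rule jacobi[OF assms(1,2)])
  ultimately show ?thesis
    by (simp add: creation creation_regular)
qed

lemma commutator_translation:
  assumes "v \<in> par \<beta>"
  shows "Y v n (Y \<omega> 0 w) = Y \<omega> 0 (Y v n w) + scale (of_int n) (Y v (n - 1) w)"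
proof -
  have "Y \<omega> 0 (Y v n w) - Y v n (Y \<omega> 0 w) = Y (Y \<omega> 0 v) n w"
    using commutator_formula[OF omega_even assms, of 0 n w] by (simp add: parity_sign_def)
  also have "\<dots> = - scale (of_int n) (Y v (n - 1) w)"
    using translation[of v n w] by (simp add: virasoro_def)
  finally show ?thesis
    by (simp add: algebra_simps)
qed

lemma translation_zero_mode: "Y (Y \<omega> 0 v) n w = scale (- of_int n) (Y v (n - 1) w)"
  using translation[of v n w] by (simp add: virasoro_def)

text \<open>
  The commutator of \<open>L(0)\<close> with \<open>v_n\<close> is \<open>(L(-1)v)_(n+1) + (L(0)v)_n\<close>, where the first term is
  \<open>-(n+1) v_n\<close> by the translation axiom.
\<close>

lemma wt_mode:
  assumes v: "v \<in> par \<beta>" "v \<in> wt p" and w: "w \<in> wt q" and r: "r = p + q - of_int n - 1"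
  shows "Y v n w \<in> wt r"
proof -
  have "Y \<omega> 1 (Y v n w) - Y v n (Y \<omega> 1 w) = Y (Y \<omega> 0 v) (1 + n) w + Y (Y \<omega> 1 v) n w"
    using commutator_formula[OF omega_even v(1), of 1 n w] by (simp add: parity_sign_def)
  then have "Y \<omega> 1 (Y v n w)
      = scale q (Y v n w) + scale (- of_int (1 + n)) (Y v n w) + scale p (Y v n w)"
    using v(2) w unfolding translation_zero_mode
    by (simp add: weight_space_def virasoro_def mode_scale state_scale algebra_simps)
  also have "\<dots> = scale r (Y v n w)"
    unfolding r scale_left_distrib[symmetric] by (simp add: algebra_simps)
  finally show ?thesis
    by (simp add: weight_space_def virasoro_def)
qed

lemma vac_wt: "vac \<in> wt 0"
  by (simp add: weight_space_def virasoro_def creation_regular)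

lemma omega_wt: "\<omega> \<in> wt 2"
proof -
  obtain c where "\<forall>m n v.
         virasoro Y \<omega> m (virasoro Y \<omega> n v) - virasoro Y \<omega> n (virasoro Y \<omega> m v) =
         scale (of_int (m - n)) (virasoro Y \<omega> (m + n) v)
         + (if m + n = 0 then scale (of_int (m ^ 3 - m) / 12 * c) v else 0)"
    using virasoro_relations by blast
  from this[rule_format, of 0 "-2" vac] show ?thesis
    by (simp add: virasoro_def weight_space_def creation creation_regular)
qed

text \<open>
  The relation \<open>[L(1), L(-1)] = 2 L(0)\<close>; the central term vanishes as \<open>1^3 - 1 = 0\<close>. On
  vectors of nonzero weight that \<open>L(1)\<close> annihilates, \<open>L(1)\<close> thus inverts \<open>L(-1)\<close> up to a scalar.
\<close>

lemma L1_L_minus1: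
  assumes "w \<in> wt q"
  shows "Y \<omega> 2 (Y \<omega> 0 w) = Y \<omega> 0 (Y \<omega> 2 w) + scale (2 * q) w"
proof -
  obtain c where "\<forall>m n v.
         virasoro Y \<omega> m (virasoro Y \<omega> n v) - virasoro Y \<omega> n (virasoro Y \<omega> m v) =
         scale (of_int (m - n)) (virasoro Y \<omega> (m + n) v)
         + (if m + n = 0 then scale (of_int (m ^ 3 - m) / 12 * c) v else 0)"
    using virasoro_relations by blast
  from this[rule_format, of 1 "-1" w] assms show ?thesis
    by (simp add: virasoro_def weight_space_def algebra_simps)
qed


end

section \<open>Weight spaces of low weight\<close>

locale superalgebra_generated_in_weights_3_2_and_2 = conformal_vertex_superalgebra scale Y vac \<omega>
  for scale :: "complex \<Rightarrow> 'v::ab_group_add \<Rightarrow> 'v" and Y vac \<omega> +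
  assumes strong_generation: "strongly_generated_by scale Y vac
           {x + y | x y. x \<in> weight_space scale Y \<omega> (3/2) \<and> y \<in> weight_space scale Y \<omega> 2}"
begin

text \<open>
  An upper bound for the span of the generating monomials of weight \<open>q\<close>. Taking all of \<open>V_q\<close> for
  half-integers \<open>q \<ge> 3/2\<close> other than \<open>5/2\<close> makes the family stable under the creation modes of the
  generators by counting weights alone, except where weight \<open>5/2\<close> is reached.
\<close>

definition predicted_wt :: "complex \<Rightarrow> 'v set" where
  "predicted_wt q =
     (if q = 0 then range (\<lambda>c. scale c vac)
      else if q = 5/2 then Y \<omega> 0 ` wt (3/2)
      else if \<exists>k::int. k \<ge> 3 \<and> q = of_int k / 2 then wt q
      else {0})"

lemma subspace_predicted_wt: "subspace (predicted_wt q)"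
proof -
  have "subspace (range (\<lambda>c. scale c vac))"
    unfolding subspace_def
  proof (intro conjI ballI allI)
    show "0 \<in> range (\<lambda>c. scale c vac)"
      by (rule range_eqI[of _ _ 0]) simp
  qed (auto simp flip: scale_left_distrib)
  moreover have "subspace (Y \<omega> 0 ` wt (3/2))"
    by (rule module_hom.subspace_image[OF _ subspace_wt])
      (use linear_mode[of \<omega> 0] in \<open>simp add: linear_iff_module_hom\<close>)
  moreover have "subspace {0}"
    by (rule subspace_single_0)
  ultimately show ?thesis
    using subspace_wt[of q] by (simp add: predicted_wt_def)
qed

lemma predicted_wt_subset: "predicted_wt q \<subseteq> wt q"
proof -
  have "Y \<omega> 0 v \<in> wt (5/2)" if "v \<in> wt (3/2)" for v
    by (rule wt_mode[OF omega_even omega_wt that]) simp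
  then have "q = 5/2 \<Longrightarrow> Y \<omega> 0 ` wt (3/2) \<subseteq> wt q"
    by blast
  moreover have "q = 0 \<Longrightarrow> range (\<lambda>c. scale c vac) \<subseteq> wt q"
    using subspace_scale[OF subspace_wt vac_wt] by blast
  moreover have "{0} \<subseteq> wt q"
    using subspace_0[OF subspace_wt] by blast
  ultimately show ?thesis
    by (simp add: predicted_wt_def)
qed

lemma predicted_wt_non_half_integer:
  assumes "2 * q \<notin> \<int>"
  shows "predicted_wt q = {0}"
proof -
  have "2 * q \<in> \<int>" if "q = of_int k / 2" for k :: int
    unfolding that by simp
  then have "q \<noteq> of_int k / 2" for k :: int
    using assms by blast
  from this[of 0] this[of 5] this show ?thesis
    by (simp add: predicted_wt_def)
qed

lemma predicted_wt_0: "predicted_wt 0 = range (\<lambda>c. scale c vac)"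
  by (simp add: predicted_wt_def)

lemma predicted_wt_5_2: "predicted_wt (5/2) = Y \<omega> 0 ` wt (3/2)"
  by (simp add: predicted_wt_def)

lemma predicted_wt_large:
  assumes "k \<ge> 3" "k \<noteq> 5"
  shows "predicted_wt (of_int k / 2) = wt (of_int k / 2)"
proof -
  have "(of_int k / 2 :: complex) \<noteq> 0"
    using assms(1) by simp
  moreover have "(of_int k / 2 :: complex) \<noteq> 5 / 2"
    using assms(2) of_int_eq_iff[of k 5, where 'a = complex] by simp
  ultimately show ?thesis
    using assms(1) unfolding predicted_wt_def by auto
qed

text \<open>
  With \<open>q = k/2\<close> the vector \<open>a_(-n) w\<close> has weight \<open>(j + k + 2n - 2)/2\<close>. For \<open>k \<ge> 3\<close> this is at least
  \<open>3\<close>. For \<open>w\<close> a multiple of the vacuum it is at least \<open>3/2\<close>, and it is the exceptional weight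
  \<open>5/2\<close> only for \<open>j = 3\<close>, \<open>n = 2\<close>, in which case \<open>a_(-2) 1 = L(-1) a\<close>.
\<close>

lemma mode_predicted_wt:
  assumes a: "a \<in> wt (of_int j / 2)" and j: "j = 3 \<or> j = 4" and n: "n > 0"
    and w: "w \<in> predicted_wt q"
  shows "\<exists>r. Y a (- int n) w \<in> predicted_wt r"
proof -
  have par: "\<exists>\<beta>. a \<in> par \<beta>"
    using j
  proof
    assume "j = 3"
    then show ?thesis
      using wt_parity_odd[of a 1] a by auto
  next
    assume "j = 4"
    then show ?thesis
      using wt_parity_even[of a 2] a by auto
  qed
  have mode: "Y a (- int n) x \<in> wt (of_int (j + k + 2 * int n - 2) / 2)"
    if "x \<in> wt (of_int k / 2)" for x k
  proof -
    from par obtain \<beta> where "a \<in> par \<beta>"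
      by blast
    then show ?thesis
      by (rule wt_mode[OF _ a that]) (simp add: field_simps)
  qed
  have large: "Y a (- int n) x \<in> predicted_wt (of_int (j + k + 2 * int n - 2) / 2)"
    if "x \<in> wt (of_int k / 2)" "j + k + 2 * int n - 2 \<ge> 3" "j + k + 2 * int n - 2 \<noteq> 5" for x k
    using mode[OF that(1)] predicted_wt_large[OF that(2,3)] by blast
  have zero: "\<exists>r. 0 \<in> predicted_wt r"
    using subspace_0[OF subspace_predicted_wt] by blast
  \<comment> \<open>The weights \<open>k/2\<close> with \<open>k \<ge> 3\<close> include the exceptional \<open>5/2\<close>, which maps into weights \<open>\<ge> 4\<close>.\<close>
  have high: ?thesis if "k \<ge> 3" "q = of_int k / 2" for k :: int
  proof -
    have "w \<in> wt (of_int k / 2)"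
      using w predicted_wt_subset that(2) by blast
    moreover have "j + k + 2 * int n - 2 \<ge> 3" "j + k + 2 * int n - 2 \<noteq> 5"
      using j n that(1) by presburger+
    ultimately show ?thesis
      using large by blast
  qed
  show ?thesis
  proof (cases "q = 0")
    case True
    then obtain c where c: "w = scale c vac"
      using w by (auto simp: predicted_wt_0)
    have w0: "w \<in> wt (of_int 0 / 2)"
      using w predicted_wt_subset True by auto
    show ?thesis
    proof (cases "j = 3 \<and> n = 2")
      case True
      have "Y a (-2) vac = Y (Y \<omega> 0 a) (-1) vac"
        by (simp add: translation_zero_mode)
      then have "Y a (- int n) w = Y \<omega> 0 (scale c a)"
        using True by (simp add: c mode_scale creation)
      moreover have "scale c a \<in> wt (3/2)"
        using subspace_scale[OF subspace_wt a] True by simp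
      ultimately have "Y a (- int n) w \<in> predicted_wt (5/2)"
        unfolding predicted_wt_5_2 by blast
      then show ?thesis
        by blast
    next
      case False
      then have "j + 0 + 2 * int n - 2 \<ge> 3" "j + 0 + 2 * int n - 2 \<noteq> 5"
        using j n by presburger+
      then show ?thesis
        using large[OF w0] by blast
    qed
  next
    case False
    show ?thesis
    proof (cases "w = 0")
      case True
      then show ?thesis
        using zero by simp
    next
      case w_nonzero: False
      show ?thesis
      proof (cases "q = 5/2")
        case True
        then show ?thesis
          using high[of 5] by simp
      next
        case q: False
        then have "\<exists>k::int. k \<ge> 3 \<and> q = of_int k / 2"
          using w w_nonzero False unfolding predicted_wt_def by (metis singletonD)
        then show ?thesis
          using high by blast
      qed
    qed
  qed
qed

lemma span_predicted_wt: "span (\<Union>q. predicted_wt q) = UNIV"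
proof -
  let ?U = "span (\<Union>q. predicted_wt q)"
  have homogeneous: "Y a (- int n) w \<in> ?U"
    if a: "a \<in> wt (of_int j / 2)" "j = 3 \<or> j = 4" "n > 0" and w: "w \<in> ?U" for a j n w
  proof -
    have "subspace {w. Y a (- int n) w \<in> ?U}"
      by (auto simp: subspace_def mode_add mode_scale intro: span_add span_scale span_zero)
    moreover have "(\<Union>q. predicted_wt q) \<subseteq> {w. Y a (- int n) w \<in> ?U}"
    proof
      fix w assume "w \<in> (\<Union>q. predicted_wt q)"
      then obtain r where "Y a (- int n) w \<in> predicted_wt r"
        using mode_predicted_wt[OF a] by blast
      then show "w \<in> {w. Y a (- int n) w \<in> ?U}"
        by (auto intro: span_base)
    qed
    ultimately show ?thesis
      using span_minimal w by blast
  qed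
  have vac: "vac \<in> ?U"
  proof (rule span_base)
    have "vac \<in> predicted_wt 0"
      unfolding predicted_wt_0 by (rule range_eqI[of _ _ 1]) simp
    then show "vac \<in> (\<Union>q. predicted_wt q)"
      by blast
  qed
  have monomial: "foldr (\<lambda>(a, n) w. Y a (- int n) w) xs vac \<in> ?U"
    if "\<forall>(a, n) \<in> set xs. a \<in> {x + y | x y. x \<in> wt (3/2) \<and> y \<in> wt 2} \<and> n > 0" for xs
    using that
  proof (induction xs)
    case Nil
    then show ?case
      using vac by simp
  next
    case (Cons p xs)
    obtain x y n where p: "p = (x + y, n)" "x \<in> wt (3/2)" "y \<in> wt 2" "n > 0"
      using Cons.prems by (cases p) auto
    have w: "foldr (\<lambda>(a, n) w. Y a (- int n) w) xs vac \<in> ?U"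
      using Cons by simp
    show ?case
      using homogeneous[of x 3 n, OF _ _ _ w] homogeneous[of y 4 n, OF _ _ _ w] p
      by (simp add: state_add span_add)
  qed
  have "insert vac {foldr (\<lambda>(a, n) w. Y a (- int n) w) xs vac | xs. xs \<noteq> [] \<and>
      (\<forall>(a, n) \<in> set xs. a \<in> {x + y | x y. x \<in> wt (3/2) \<and> y \<in> wt 2} \<and> n > 0)} \<subseteq> ?U"
  proof (intro insert_subsetI vac subsetI, elim CollectE exE conjE)
    fix v xs
    assume v: "v = foldr (\<lambda>(a, n) w. Y a (- int n) w) xs vac"
      and xs: "\<forall>(a, n) \<in> set xs. a \<in> {x + y | x y. x \<in> wt (3/2) \<and> y \<in> wt 2} \<and> n > 0"
    show "v \<in> ?U"
      unfolding v by (rule monomial[OF xs])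
  qed
  then have "UNIV \<subseteq> ?U"
    using strong_generation unfolding strongly_generated_by_def
    by (metis (lifting) span_minimal subspace_span)
  then show ?thesis
    by (rule top_le)
qed

text \<open>
  The predicted parts lie inside the weight spaces and together span \<open>V\<close>. As the sum of the weight
  spaces is direct, a decomposition of \<open>v \<in> V_q\<close> along the predicted parts must be the trivial one, so
  \<open>v\<close> itself lies in the predicted part.
\<close>

lemma wt_eq_predicted_wt:
  assumes q: "2 * q \<in> \<int>"
  shows "wt q = predicted_wt q"
proof
  show "predicted_wt q \<subseteq> wt q"
    by (rule predicted_wt_subset)
next
  define D where
    "D = {v. \<exists>f. (\<forall>q. f q \<in> predicted_wt q) \<and> finite {q. f q \<noteq> 0} \<and> Sum_any f = v}"
  have single: "finite {r. (if r = q then x else 0) \<noteq> 0}"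
    "Sum_any (\<lambda>r. if r = q then x else 0) = x" for x :: 'v and q :: complex
  proof -
    have sub: "{r. (if r = q then x else 0) \<noteq> 0} \<subseteq> {q}"
      by auto
    then show "finite {r. (if r = q then x else 0) \<noteq> 0}"
      using finite_subset by blast
    show "Sum_any (\<lambda>r. if r = q then x else 0) = x"
      using Sum_any.expand_superset[OF _ sub] by simp
  qed
  have "subspace D"
    unfolding subspace_def
  proof (intro conjI ballI allI)
    show "0 \<in> D"
      unfolding D_def using subspace_0[OF subspace_predicted_wt]
      by (intro CollectI exI[of _ "\<lambda>_. 0"]) auto
  next
    fix v w assume "v \<in> D" "w \<in> D"
    then obtain f g where f: "\<forall>q. f q \<in> predicted_wt q" "finite {q. f q \<noteq> 0}" "Sum_any f = v"
      and g: "\<forall>q. g q \<in> predicted_wt q" "finite {q. g q \<noteq> 0}" "Sum_any g = w"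
      unfolding D_def by auto
    have "finite {q. f q + g q \<noteq> 0}"
      by (rule finite_subset[OF _ finite_UnI[OF f(2) g(2)]]) auto
    then show "v + w \<in> D"
      unfolding D_def using f g subspace_add[OF subspace_predicted_wt]
      by (intro CollectI exI[of _ "\<lambda>q. f q + g q"]) (auto simp: Sum_any.distrib)
  next
    fix c v assume "v \<in> D"
    then obtain f where f: "\<forall>q. f q \<in> predicted_wt q" "finite {q. f q \<noteq> 0}" "Sum_any f = v"
      unfolding D_def by auto
    have sub: "{q. scale c (f q) \<noteq> 0} \<subseteq> {q. f q \<noteq> 0}"
      by auto
    have "Sum_any (\<lambda>q. scale c (f q)) = scale c v"
      unfolding Sum_any.expand_superset[OF f(2) sub] f(3)[symmetric] Sum_any.expand_set
      by (simp add: scale_sum_right)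
    then show "scale c v \<in> D"
      unfolding D_def using f(1) finite_subset[OF sub f(2)]
        subspace_scale[OF subspace_predicted_wt]
      by (intro CollectI exI[of _ "\<lambda>q. scale c (f q)"]) auto
  qed
  moreover have "(\<Union>q. predicted_wt q) \<subseteq> D"
  proof
    fix x assume "x \<in> (\<Union>q. predicted_wt q)"
    then obtain q where "x \<in> predicted_wt q"
      by blast
    then show "x \<in> D"
      unfolding D_def using single[of q x] subspace_0[OF subspace_predicted_wt]
      by (intro CollectI exI[of _ "\<lambda>r. if r = q then x else 0"]) auto
  qed
  ultimately have D: "D = UNIV"
    using span_minimal span_predicted_wt by blast
  show "wt q \<subseteq> predicted_wt q"
  proof
    fix v assume v: "v \<in> wt q"
    obtain f where f: "\<forall>q. f q \<in> predicted_wt q" "finite {q. f q \<noteq> 0}" "Sum_any f = v"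
      using D unfolding D_def by blast
    have supp: "f r = 0" if "2 * r \<notin> \<int>" for r
      using f(1) predicted_wt_non_half_integer[OF that] by blast
    \<comment> \<open>The decomposition of \<open>v\<close> into weight components that has \<open>v\<close> as its only component.\<close>
    define g where "g = (\<lambda>r. if r = q then v else 0)"
    have "\<exists>!h. (\<forall>r\<in>{r. 2 * r \<in> \<int>}. h r \<in> wt r) \<and> (\<forall>r. r \<notin> {r. 2 * r \<in> \<int>} \<longrightarrow> h r = 0)
        \<and> finite {r. h r \<noteq> 0} \<and> (\<Sum>r | h r \<noteq> 0. h r) = v"
      using grading unfolding is_direct_sum_def by (rule spec)
    then have unique: "f = h" if "\<forall>r\<in>{r. 2 * r \<in> \<int>}. h r \<in> wt r" "\<forall>r. r \<notin> {r. 2 * r \<in> \<int>} \<longrightarrow> h r = 0"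
        "finite {r. h r \<noteq> 0}" "(\<Sum>r | h r \<noteq> 0. h r) = v" for h
    proof (elim ex1E)
      fix k
      assume "\<forall>y. (\<forall>r\<in>{r. 2 * r \<in> \<int>}. y r \<in> wt r) \<and> (\<forall>r. r \<notin> {r. 2 * r \<in> \<int>} \<longrightarrow> y r = 0)
        \<and> finite {r. y r \<noteq> 0} \<and> (\<Sum>r | y r \<noteq> 0. y r) = v \<longrightarrow> y = k"
      note k = this[rule_format, OF conjI[OF _ conjI[OF _ conjI]]]
      have "f = k"
        using f supp predicted_wt_subset by (intro k) (unfold Sum_any.expand_set, blast+)
      moreover have "h = k"
        using that by (intro k) auto
      ultimately show "f = h"
        by simp
    qed
    have "f = g"
    proof (rule unique)
      show "\<forall>r\<in>{r. 2 * r \<in> \<int>}. g r \<in> wt r"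
        unfolding g_def using v subspace_0[OF subspace_wt] by simp
      show "\<forall>r. r \<notin> {r. 2 * r \<in> \<int>} \<longrightarrow> g r = 0"
        unfolding g_def using q by auto
      show "finite {r. g r \<noteq> 0}" "(\<Sum>r | g r \<noteq> 0. g r) = v"
        using single[of q v] unfolding g_def Sum_any.expand_set .
    qed
    then have "f q = v"
      by (simp add: g_def)
    then show "v \<in> predicted_wt q"
      using f(1) by metis
  qed
qed

lemma wt_0: "wt 0 = range (\<lambda>c. scale c vac)"
  by (subst wt_eq_predicted_wt) (auto simp: predicted_wt_0)

lemma wt_5_2: "wt (5/2) = Y \<omega> 0 ` wt (3/2)"
  by (subst wt_eq_predicted_wt) (auto simp: predicted_wt_5_2)

lemma wt_trivial:
  fixes k :: int
  assumes "k < 3" "k \<noteq> 0"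
  shows "wt (of_int k / 2) = {0}"
proof -
  have "(of_int k / 2 :: complex) \<noteq> 5 / 2"
    using assms of_int_eq_iff[of k 5, where 'a = complex] by simp
  moreover have "\<not> (\<exists>l::int. l \<ge> 3 \<and> (of_int k / 2 :: complex) = of_int l / 2)"
    using assms by auto
  ultimately show ?thesis
    using assms by (subst wt_eq_predicted_wt) (auto simp: predicted_wt_def)
qed

end

section \<open>The products on \<open>V_2\<close> and \<open>V_(3/2)\<close>\<close>

context superalgebra_generated_in_weights_3_2_and_2
begin

lemma wt_2_even: "a \<in> wt 2 \<Longrightarrow> a \<in> par 0"
  using wt_parity_even[of a 2] by simp

lemma wt_3_2_odd: "u \<in> wt (3/2) \<Longrightarrow> u \<in> par 1"
  using wt_parity_odd[of u 1] by simp

lemma wt_2_mode_wt_2: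
  assumes "a \<in> wt 2" "b \<in> wt 2"
  shows "Y a n b \<in> wt (of_int (6 - 2 * n) / 2)"
  by (rule wt_mode[OF wt_2_even[OF assms(1)] assms]) (simp add: field_simps)

lemma wt_2_mode_wt_3_2:
  assumes "a \<in> wt 2" "v \<in> wt (3/2)"
  shows "Y a n v \<in> wt (of_int (5 - 2 * n) / 2)"
  by (rule wt_mode[OF wt_2_even[OF assms(1)] assms]) (simp add: field_simps)

lemma wt_3_2_mode_wt_3_2:
  assumes "u \<in> wt (3/2)" "v \<in> wt (3/2)"
  shows "Y u n v \<in> wt (of_int (4 - 2 * n) / 2)"
  by (rule wt_mode[OF wt_3_2_odd[OF assms(1)] assms]) (simp add: field_simps)

lemma wt_2_mode_wt_2_vanishes:
  assumes "a \<in> wt 2" "b \<in> wt 2" "n \<ge> 2" "n \<noteq> 3"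
  shows "Y a n b = 0"
proof -
  have "6 - 2 * n < 3" "6 - 2 * n \<noteq> 0"
    using assms(3,4) by presburger+
  then show ?thesis
    using wt_2_mode_wt_2[OF assms(1,2), of n] wt_trivial by blast
qed

lemma wt_2_mode_wt_3_2_vanishes:
  assumes "a \<in> wt 2" "v \<in> wt (3/2)" "n \<ge> 2"
  shows "Y a n v = 0"
proof -
  have "5 - 2 * n < 3" "5 - 2 * n \<noteq> 0"
    using assms(3) by presburger+
  then show ?thesis
    using wt_2_mode_wt_3_2[OF assms(1,2), of n] wt_trivial by blast
qed

lemma wt_3_2_mode_wt_3_2_vanishes:
  assumes "u \<in> wt (3/2)" "v \<in> wt (3/2)" "n \<ge> 1" "n \<noteq> 2"
  shows "Y u n v = 0"
proof -
  have "4 - 2 * n < 3" "4 - 2 * n \<noteq> 0"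
    using assms(3,4) by presburger+
  then show ?thesis
    using wt_3_2_mode_wt_3_2[OF assms(1,2), of n] wt_trivial by blast
qed

lemma product_closed:
  assumes "a \<in> wt 2" "b \<in> wt 2"
  shows "Y a 1 b \<in> wt 2"
  using wt_2_mode_wt_2[OF assms, of 1] by simp

lemma action_closed:
  assumes "a \<in> wt 2" "v \<in> wt (3/2)"
  shows "Y a 1 v \<in> wt (3/2)"
  using wt_2_mode_wt_3_2[OF assms, of 1] by simp

lemma circ_closed:
  assumes "u \<in> wt (3/2)" "v \<in> wt (3/2)"
  shows "Y u 0 v \<in> wt 2"
  using wt_3_2_mode_wt_3_2[OF assms, of 0] by simp

lemma vac_coeff_scale_vac [simp]: "vac_coeff scale vac (scale c vac) = c"
  unfolding vac_coeff_def using vac_nonzero by (intro the_equality) auto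

text \<open>
  For weight zero \<open>vac_coeff\<close> is a genuine coefficient: \<open>V_0\<close> is spanned by the nonzero vacuum.
\<close>

lemma wt_0_vac_coeff:
  assumes "w \<in> wt 0"
  shows "w = scale (vac_coeff scale vac w) vac"
  using assms by (auto simp: wt_0)

lemma vac_coeff_add:
  assumes "w \<in> wt 0" "w' \<in> wt 0"
  shows "vac_coeff scale vac (w + w') = vac_coeff scale vac w + vac_coeff scale vac w'"
  using assms by (auto simp: wt_0 simp flip: scale_left_distrib)

lemma vac_coeff_scale:
  assumes "w \<in> wt 0"
  shows "vac_coeff scale vac (scale c w) = c * vac_coeff scale vac w"
  using assms by (auto simp: wt_0)

lemma wt_2_form:
  assumes "a \<in> wt 2" "b \<in> wt 2"
  shows "Y a 3 b \<in> wt 0"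
  using wt_2_mode_wt_2[OF assms, of 3] by simp

lemma wt_3_2_form:
  assumes "u \<in> wt (3/2)" "v \<in> wt (3/2)"
  shows "Y u 2 v \<in> wt 0"
  using wt_3_2_mode_wt_3_2[OF assms, of 2] by simp

lemma vac_mode_wt_0:
  assumes "w \<in> wt 0" "n \<noteq> -1"
  shows "Y w n x = 0"
  using assms by (auto simp: wt_0 state_scale vacuum_mode)

lemma mode_wt_0:
  assumes "w \<in> wt 0" "n \<ge> 0"
  shows "Y x n w = 0"
  using assms by (auto simp: wt_0 mode_scale creation_regular)

lemma omega_product: "a \<in> wt q \<Longrightarrow> Y \<omega> 1 a = scale q a"
  by (simp add: weight_space_def virasoro_def)

text \<open>
  The corrections in skew symmetry come from \<open>a_i b\<close> with \<open>i \<ge> 2\<close>. Of these only \<open>a_3 b\<close> can be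
  nonzero, and it is a multiple of the vacuum, whose mode \<open>-3\<close> is zero.
\<close>

lemma product_commute:
  assumes "a \<in> wt 2" "b \<in> wt 2"
  shows "Y a 1 b = Y b 1 a"
proof -
  have "Y (Y a (1 + int i) b) (- 1 - int i) vac = 0" if "i > 0" for i
  proof (cases "i = 2")
    case True
    then show ?thesis
      using vac_mode_wt_0[OF wt_2_form[OF assms]] by simp
  next
    case False
    then show ?thesis
      using that wt_2_mode_wt_2_vanishes[OF assms, of "1 + int i"] by simp
  qed
  then show ?thesis
    using skew_symmetry[OF assms[THEN wt_2_even], of 1] by (simp add: parity_sign_def)
qed

text \<open>
  Both vectors are odd, so the sign of exchanging them cancels the one in skew symmetry; the
  corrections vanish as \<open>u_n v\<close> has negative weight for \<open>n > 2\<close>.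
\<close>

lemma form_commute:
  assumes "u \<in> wt (3/2)" "v \<in> wt (3/2)"
  shows "Y u 2 v = Y v 2 u"
  using skew_symmetry[OF assms[THEN wt_3_2_odd], of 2] wt_3_2_mode_wt_3_2_vanishes[OF assms]
  by (simp add: parity_sign_def)

lemma circ_commute:
  assumes "u \<in> wt (3/2)" "v \<in> wt (3/2)"
  shows "Y u 0 v = Y v 0 u"
proof -
  have "Y (Y u (0 + int i) v) (- 1 - int i) vac = 0" if "i > 0" for i
  proof (cases "i = 2")
    case True
    then show ?thesis
      using vac_mode_wt_0[OF wt_3_2_form[OF assms]] by simp
  next
    case False
    then show ?thesis
      using that wt_3_2_mode_wt_3_2_vanishes[OF assms, of "int i"] by simp
  qed
  then show ?thesis
    using skew_symmetry[OF assms[THEN wt_3_2_odd], of 0] by (simp add: parity_sign_def)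
qed

text \<open>
  Since \<open>V_(5/2) = L(-1)V_(3/2)\<close>, one has \<open>a_0 v = L(-1)w\<close>, and \<open>L(1)\<close> recovers \<open>w\<close>: it annihilates
  \<open>V_(3/2)\<close> because \<open>V_(1/2) = 0\<close>, so \<open>L(1)L(-1)w = 2 L(0)w = 3w\<close>, while the commutator of \<open>L(1)\<close>
  with \<open>a_0\<close> gives \<open>L(1)a_0 v = (L(-1)a)_2 v + 2(L(0)a)_1 v + (L(1)a)_0 v = (-2 + 4 + 0) a_1 v\<close>.
\<close>

lemma mode_0_eq_translation:
  assumes a: "a \<in> wt 2" and v: "v \<in> wt (3/2)"
  shows "Y a 0 v = scale (2/3) (Y \<omega> 0 (Y a 1 v))"
proof -
  have "Y a 0 v \<in> wt (5/2)"
    using wt_2_mode_wt_3_2[OF a v, of 0] by simp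
  then obtain w where w: "w \<in> wt (3/2)" "Y a 0 v = Y \<omega> 0 w"
    using wt_5_2 by auto
  have L1_zero: "Y \<omega> 2 x = 0" if "x \<in> wt (3/2)" for x
    using wt_2_mode_wt_3_2_vanishes[OF omega_wt that] by simp
  have twice: "scale 4 x - scale 2 x = scale 2 x" for x
    unfolding scale_left_diff_distrib[symmetric] by simp
  have "Y \<omega> 2 (Y a 0 v) = (\<Sum>i\<le>2. scale (of_nat (2 choose i)) (Y (Y \<omega> (int i) a) (2 - int i) v))"
    using commutator_formula[OF omega_even wt_2_even[OF a], of 2 0 v] L1_zero[OF v] by simp
  also have "\<dots> = scale 2 (Y a 1 v)"
    using wt_2_mode_wt_2_vanishes[OF omega_wt a, of 2]
    by (simp add: numeral_2_eq_2 translation_zero_mode omega_product[OF a] state_scale twice)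
  finally have "scale 2 (Y a 1 v) = scale 3 w"
    unfolding w(2) using L1_L_minus1[OF w(1)] L1_zero[OF w(1)] by simp
  then have "scale (1/3) (scale 3 w) = scale (1/3) (scale 2 (Y a 1 v))"
    by (rule arg_cong[OF sym])
  then have "w = scale (2/3) (Y a 1 v)"
    by simp
  then show ?thesis
    using w(2) by (simp add: mode_scale)
qed

text \<open>
  With \<open>a_0 v = (2/3)L(-1)a_1 v\<close>, moving \<open>L(-1)\<close> to the left of \<open>x_n\<close> lowers the mode; the hypothesis
  removes the term in which \<open>L(-1)\<close> ends up in front.
\<close>

lemma mode_after_mode_0:
  assumes a: "a \<in> wt 2" and v: "v \<in> wt (3/2)" and x: "x \<in> par \<beta>" "Y x n (Y a 1 v) = 0"
  shows "Y x n (Y a 0 v) = scale (2/3 * of_int n) (Y x (n - 1) (Y a 1 v))"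
  using commutator_translation[OF x(1), of n "Y a 1 v"] x(2)
  by (simp add: mode_0_eq_translation[OF a v] mode_scale)

lemma mode_of_mode_0:
  assumes a: "a \<in> wt 2" and v: "v \<in> wt (3/2)"
  shows "Y (Y a 0 v) n x = scale (- 2/3 * of_int n) (Y (Y a 1 v) (n - 1) x)"
  by (simp add: mode_0_eq_translation[OF a v] state_scale translation_zero_mode)

text \<open>
  In the expansion of \<open>(a_1 b)_1\<close> on \<open>v\<close> the term \<open>a_0 b_2 v\<close> vanishes and \<open>b_2 a_0 v = (4/3) b_1 a_1 v\<close>,
  of which \<open>b_1 a_1 v\<close> is cancelled.
\<close>

lemma action_of_product_split:
  assumes a: "a \<in> wt 2" and b: "b \<in> wt 2" and v: "v \<in> wt (3/2)"
  shows "Y (Y a 1 b) 1 v = Y a 1 (Y b 1 v) + scale (1/3) (Y b 1 (Y a 1 v))"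
proof -
  have "Y b 2 (Y a 0 v) = scale (1 + 1/3) (Y b 1 (Y a 1 v))"
    using mode_after_mode_0[OF a v wt_2_even[OF b], of 2]
      wt_2_mode_wt_3_2_vanishes[OF b action_closed[OF a v]] by simp
  then show ?thesis
    using first_product_formula[OF wt_2_even[OF a] wt_2_even[OF b], of 1 v]
      wt_2_mode_wt_3_2_vanishes[OF b v, of 2]
    unfolding scale_left_distrib by simp
qed

text \<open>
  The left hand side is symmetric in \<open>a\<close> and \<open>b\<close>, so \<open>action_of_product_split\<close> for both orders
  forces the operators \<open>a_1\<close> and \<open>b_1\<close> to commute on \<open>V_(3/2)\<close>. Substituting this back gives the
  factor \<open>1 + 1/3\<close>.
\<close>

lemma action_of_product:
  assumes a: "a \<in> wt 2" and b: "b \<in> wt 2" and v: "v \<in> wt (3/2)"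
  shows "Y (Y a 1 b) 1 v = scale (4/3) (Y a 1 (Y b 1 v))"
proof -
  have "Y a 1 (Y b 1 v) + scale (1/3) (Y b 1 (Y a 1 v))
      = Y b 1 (Y a 1 v) + scale (1/3) (Y a 1 (Y b 1 v))"
    unfolding action_of_product_split[OF a b v, symmetric]
      action_of_product_split[OF b a v, symmetric] product_commute[OF a b] ..
  then have "Y b 1 (Y a 1 v) = Y a 1 (Y b 1 v)"
    by (rule linear_relation_cancel[symmetric]) simp
  then show ?thesis
    unfolding action_of_product_split[OF a b v] using scale_left_distrib[of 1 "1/3"] by simp
qed

text \<open>
  In the expansion of \<open>(a_1 u)_2\<close> on \<open>v\<close> the terms \<open>a_1 u_2 v\<close> and \<open>a_0 u_3 v\<close> vanish, and
  \<open>u_3 a_0 v\<close> is \<open>2 u_2 a_1 v\<close>, from which \<open>u_2 a_1 v\<close> is subtracted.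
\<close>

lemma form_invariant:
  assumes a: "a \<in> wt 2" and u: "u \<in> wt (3/2)" and v: "v \<in> wt (3/2)"
  shows "Y (Y a 1 u) 2 v = Y u 2 (Y a 1 v)"
proof -
  have "Y u 3 (Y a 0 v) = scale 2 (Y u 2 (Y a 1 v))"
    using mode_after_mode_0[OF a v wt_3_2_odd[OF u], of 3]
      wt_3_2_mode_wt_3_2_vanishes[OF u action_closed[OF a v], of 3] by simp
  moreover have "scale 2 (Y u 2 (Y a 1 v)) - Y u 2 (Y a 1 v) = Y u 2 (Y a 1 v)"
    using scale_left_distrib[of 1 1] by simp
  ultimately show ?thesis
    using first_product_formula[OF wt_2_even[OF a] wt_3_2_odd[OF u], of 2 v]
      wt_3_2_mode_wt_3_2_vanishes[OF u v, of 3] mode_wt_0[OF wt_3_2_form[OF u v], of 1 a]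
    by simp
qed

text \<open>
  As \<open>a_3 v = 0\<close>, the left hand side is the commutator of \<open>a_3\<close> and \<open>u_0\<close> on \<open>v\<close>, which is
  \<open>(a_0 u)_3 v + 3 (a_1 u)_2 v\<close> because \<open>a_2 u\<close> and \<open>a_3 u\<close> vanish; the first term is \<open>-2 (a_1 u)_2 v\<close>.
\<close>

lemma form_circ:
  assumes a: "a \<in> wt 2" and u: "u \<in> wt (3/2)" and v: "v \<in> wt (3/2)"
  shows "Y a 3 (Y u 0 v) = Y (Y a 1 u) 2 v"
proof -
  have "Y a 3 (Y u 0 v) = (\<Sum>i\<le>3. scale (of_nat (3 choose i)) (Y (Y a (int i) u) (3 - int i) v))"
    using commutator_formula[OF wt_2_even[OF a] wt_3_2_odd[OF u], of 3 0 v]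
      wt_2_mode_wt_3_2_vanishes[OF a v, of 3] by simp
  also have "\<dots> = Y (Y a 0 u) 3 v + scale 3 (Y (Y a 1 u) 2 v)"
    using wt_2_mode_wt_3_2_vanishes[OF a u, of 2] wt_2_mode_wt_3_2_vanishes[OF a u, of 3]
    by (simp add: numeral_3_eq_3)
  also have "\<dots> = scale (- 2 + 3) (Y (Y a 1 u) 2 v)"
    unfolding mode_of_mode_0[OF a u] scale_left_distrib by simp
  finally show ?thesis
    by simp
qed

text \<open>
  The commutator of \<open>a_1\<close> and \<open>u_0\<close>, with \<open>(a_0 u)_1 = -(2/3) (a_1 u)_0\<close>.
\<close>

lemma product_circ_left:
  assumes a: "a \<in> wt 2" and u: "u \<in> wt (3/2)" and v: "v \<in> wt (3/2)"
  shows "Y a 1 (Y u 0 v) = Y u 0 (Y a 1 v) + scale (1/3) (Y (Y a 1 u) 0 v)"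
proof -
  have "Y a 1 (Y u 0 v) - Y u 0 (Y a 1 v) = Y (Y a 0 u) 1 v + Y (Y a 1 u) 0 v"
    using commutator_formula[OF wt_2_even[OF a] wt_3_2_odd[OF u], of 1 0 v]
    by (simp add: parity_sign_def)
  also have "\<dots> = scale (- 2/3 + 1) (Y (Y a 1 u) 0 v)"
    unfolding mode_of_mode_0[OF a u] scale_left_distrib by simp
  finally show ?thesis
    by (simp add: algebra_simps)
qed

text \<open>
  The expansion of \<open>(a_1 u)_0\<close> on \<open>v\<close>, where \<open>u_1 v = 0\<close> and \<open>u_1 a_0 v = (2/3) u_0 a_1 v\<close>. It is
  the counterpart of \<open>product_circ_left\<close> with the two sides of \<open>\<circ>\<close> exchanged.
\<close>

lemma product_circ_right:
  assumes a: "a \<in> wt 2" and u: "u \<in> wt (3/2)" and v: "v \<in> wt (3/2)"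
  shows "Y a 1 (Y u 0 v) = Y (Y a 1 u) 0 v + scale (1/3) (Y u 0 (Y a 1 v))"
proof -
  have "Y u 1 (Y a 0 v) = scale (1 - 1/3) (Y u 0 (Y a 1 v))"
    using mode_after_mode_0[OF a v wt_3_2_odd[OF u], of 1]
      wt_3_2_mode_wt_3_2_vanishes[OF u action_closed[OF a v], of 1] by simp
  then show ?thesis
    using first_product_formula[OF wt_2_even[OF a] wt_3_2_odd[OF u], of 0 v]
      wt_3_2_mode_wt_3_2_vanishes[OF u v, of 1]
    unfolding scale_left_diff_distrib by simp
qed

text \<open>
  With \<open>X\<close>, \<open>P\<close>, \<open>Q\<close> as in the introduction, \<open>P + Q/3 = X = Q + P/3\<close> gives \<open>P = Q\<close> and
  \<open>X = (1 + 1/3) P\<close>.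
\<close>

lemma circ_action:
  assumes a: "a \<in> wt 2" and u: "u \<in> wt (3/2)" and v: "v \<in> wt (3/2)"
  shows "scale (4/3) (Y (Y a 1 u) 0 v) = Y a 1 (Y u 0 v)"
    and "scale (4/3) (Y u 0 (Y a 1 v)) = Y a 1 (Y u 0 v)"
proof -
  have eq: "Y (Y a 1 u) 0 v = Y u 0 (Y a 1 v)"
    by (rule linear_relation_cancel[of _ "1/3"],
        rule trans[OF product_circ_right[OF assms, symmetric] product_circ_left[OF assms]]) simp
  show "scale (4/3) (Y u 0 (Y a 1 v)) = Y a 1 (Y u 0 v)"
    unfolding product_circ_left[OF assms] eq using scale_left_distrib[of 1 "1/3"] by simp
  then show "scale (4/3) (Y (Y a 1 u) 0 v) = Y a 1 (Y u 0 v)"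
    by (simp add: eq)
qed

end

theorem proposition3p11:
  fixes scale :: "complex \<Rightarrow> 'v::ab_group_add \<Rightarrow> 'v"
    and Y :: "'v \<Rightarrow> int \<Rightarrow> 'v \<Rightarrow> 'v"
    and vac \<omega> :: 'v
  assumes "conformal_vertex_superalgebra scale Y vac \<omega>"
    and "strongly_generated_by scale Y vac
           {x + y | x y. x \<in> weight_space scale Y \<omega> (3/2) \<and> y \<in> weight_space scale Y \<omega> 2}"
  shows
    "let V2 = weight_space scale Y \<omega> 2;
         V32 = weight_space scale Y \<omega> (3/2);
         mult = (\<lambda>a b. Y a 1 b);
         act = (\<lambda>a v. scale (4/3) (Y a 1 v));
         form2 = (\<lambda>a b. vac_coeff scale vac (Y a 3 b));
         form32 = (\<lambda>u v. vac_coeff scale vac (Y u 2 v));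
         circ = (\<lambda>u v. Y u 0 v);
         e = scale (1/2) \<omega>
     in
       bilinear_map_on scale scale scale V2 V2 V2 mult \<and>
       bilinear_map_on scale scale scale V2 V32 V32 act \<and>
       bilinear_map_on scale scale scale V32 V32 V2 circ \<and>
       bilinear_map_on scale scale (*) V2 V2 UNIV form2 \<and>
       bilinear_map_on scale scale (*) V32 V32 UNIV form32 \<and>
       (\<forall>a\<in>V2. \<forall>b\<in>V2. Y a 3 b = scale (form2 a b) vac) \<and>
       (\<forall>u\<in>V32. \<forall>v\<in>V32. Y u 2 v = scale (form32 u v) vac) \<and>
       e \<in> V2 \<and> (\<forall>a\<in>V2. mult e a = a \<and> mult a e = a) \<and>
       (\<forall>v\<in>V32. act e v = v) \<and>
       (\<forall>a\<in>V2. \<forall>b\<in>V2. \<forall>v\<in>V32. act a (act b v) = act (mult a b) v) \<and>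
       (\<forall>u\<in>V32. \<forall>v\<in>V32. form32 u v = form32 v u \<and> circ u v = circ v u) \<and>
       (\<forall>a\<in>V2. \<forall>u\<in>V32. \<forall>v\<in>V32.
          form32 (act a u) v = form32 u (act a v) \<and>
          form32 u (act a v) = 4/3 * form2 a (circ u v) \<and>
          circ (act a u) v = mult a (circ u v) \<and>
          mult a (circ u v) = circ u (act a v))"
proof -
  interpret superalgebra_generated_in_weights_3_2_and_2 scale Y vac \<omega>
    using assms unfolding superalgebra_generated_in_weights_3_2_and_2_def
      superalgebra_generated_in_weights_3_2_and_2_axioms_def by blast
  have half_omega: "scale (1/2) \<omega> \<in> wt 2"
    by (rule subspace_scale[OF subspace_wt omega_wt])
  have half_omega_product: "Y (scale (1/2) \<omega>) 1 a = a" if "a \<in> wt 2" for a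
    by (simp add: state_scale omega_product[OF that])
  have product_half_omega: "Y a 1 (scale (1/2) \<omega>) = a" if "a \<in> wt 2" for a
    using product_commute[OF that half_omega] half_omega_product[OF that] by simp
  have action_in: "scale c (Y a 1 v) \<in> wt (3/2)" if "a \<in> wt 2" "v \<in> wt (3/2)" for a v c
    by (rule subspace_scale[OF subspace_wt action_closed[OF that]])
  have associative: "scale (4/3) (Y a 1 (scale (4/3) (Y b 1 v))) = scale (4/3) (Y (Y a 1 b) 1 v)"
    if "a \<in> wt 2" "b \<in> wt 2" "v \<in> wt (3/2)" for a b v
    unfolding action_of_product[OF that] mode_scale ..
  have forms: "vac_coeff scale vac (Y (scale (4/3) (Y a 1 u)) 2 v)
        = vac_coeff scale vac (Y u 2 (scale (4/3) (Y a 1 v)))"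
      "vac_coeff scale vac (Y u 2 (scale (4/3) (Y a 1 v)))
        = 4/3 * vac_coeff scale vac (Y a 3 (Y u 0 v))"
    if "a \<in> wt 2" "u \<in> wt (3/2)" "v \<in> wt (3/2)" for a u v
    unfolding mode_scale state_scale form_circ[OF that] form_invariant[OF that]
    by (rule refl, rule vac_coeff_scale[OF wt_3_2_form[OF that(2) action_closed[OF that(1,3)]]])
  have circs: "Y (scale (4/3) (Y a 1 u)) 0 v = Y a 1 (Y u 0 v)"
      "Y a 1 (Y u 0 v) = Y u 0 (scale (4/3) (Y a 1 v))"
    if "a \<in> wt 2" "u \<in> wt (3/2)" "v \<in> wt (3/2)" for a u v
    unfolding mode_scale state_scale circ_action[OF that] by (rule refl)+
  have "bilinear_map_on scale scale scale (wt 2) (wt 2) (wt 2) (\<lambda>a b. Y a 1 b)"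
    by (simp add: bilinear_map_on_def product_closed mode_add state_add mode_scale state_scale)
  moreover have "bilinear_map_on scale scale scale (wt 2) (wt (3/2)) (wt (3/2))
      (\<lambda>a v. scale (4/3) (Y a 1 v))"
    by (simp add: bilinear_map_on_def action_in mode_add state_add mode_scale state_scale
        scale_right_distrib mult.commute)
  moreover have "bilinear_map_on scale scale scale (wt (3/2)) (wt (3/2)) (wt 2)
      (\<lambda>u v. Y u 0 v)"
    by (simp add: bilinear_map_on_def circ_closed mode_add state_add mode_scale state_scale)
  moreover have "bilinear_map_on scale scale (*) (wt 2) (wt 2) UNIV
      (\<lambda>a b. vac_coeff scale vac (Y a 3 b))"
    by (simp add: bilinear_map_on_def wt_2_form mode_add state_add mode_scale state_scale
        vac_coeff_add vac_coeff_scale)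
  moreover have "bilinear_map_on scale scale (*) (wt (3/2)) (wt (3/2)) UNIV
      (\<lambda>u v. vac_coeff scale vac (Y u 2 v))"
    by (simp add: bilinear_map_on_def wt_3_2_form mode_add state_add mode_scale state_scale
        vac_coeff_add vac_coeff_scale)
  moreover have "\<forall>v\<in>wt (3/2). scale (4/3) (Y (scale (1/2) \<omega>) 1 v) = v"
    by (simp add: state_scale omega_product)
  ultimately show ?thesis
    unfolding Let_def
    using half_omega half_omega_product product_half_omega associative forms circs
      wt_0_vac_coeff[OF wt_2_form] wt_0_vac_coeff[OF wt_3_2_form] form_commute circ_commute
    by (intro conjI ballI) (assumption | simp)+
qed

end
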